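(* Let $X$ be a set and $Y$ a finite set, let $c\colon X\to\mathcal{D}(Y)$ be a channel and $\sigma\in\mathcal{D}(X)$ a distribution such that the predicted distribution $c_{*}\sigma$ on $Y$ has full support (i.e. $(c_{*}\sigma)(y)>0$ for all $y\in Y$). Let $\tau\in\mathcal{D}(Y)$ be any distribution, and let $\sigma_J=(c^{\dagger}_{\sigma})_{*}\tau$. Then \[ D_{KL}\big(\tau,\,c_{*}\sigma_J\big)\;\leq\; D_{KL}\big(\tau,\,c_{*}\sigma\big). \]
   Context: For a set $Z$, $\mathcal{D}(Z)$ denotes the set of finitely supported probability distributions on $Z$ (functions $\omega\colon Z\to[0,1]$ with finite support summing to $1$). A channel $c\colon X\to\mathcal{D}(Y)$ assigns a distribution $c(x)$ on $Y$ to each $x\in X$. State transformation along a channel $d\colon A\to\mathcal{D}(B)$: for $\rho\in\mathcal{D}(A)$, $(d_{*}\rho)(b)=\sum_{a}\rho(a)\,d(a)(b)$. The Bayesian inversion (dagger) of $c$ with respect to $\sigma$, defined when $c_{*}\sigma$ has full support, is the channel $c^{\dagger}_{\sigma}\colon Y\to\mathcal{D}(X)$ given by $c^{\dagger}_{\sigma}(y)(x)=\sigma(x)\,c(x)(y)/(c_{*}\sigma)(y)$. Thus $\sigma_J(x)=\sum_{y}\tau(y)\,c^{\dagger}_{\sigma}(y)(x)$ (Jeffrey's update). Kullback–Leibler divergence: $D_{KL}(\omega,\rho)=\sum_{z}\omega(z)\ln\big(\omega(z)/\rho(z)\big)$, with terms where $\omega(z)=0$ taken to be $0$. *)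

theory Defs
  imports "HOL-Probability.Probability_Mass_Function" "HOL-Library.Extended_Real"
begin

text \<open>
  A finitely supported distribution on a type is a pmf with finite support; on a finite
  type every pmf is one. A channel is a pmf-valued function.
\<close>

definition state_transform :: "('a \<Rightarrow> 'b pmf) \<Rightarrow> 'a pmf \<Rightarrow> 'b pmf" where
  "state_transform d \<rho> = bind_pmf \<rho> d"

lemma pmf_state_transform:
  assumes "finite (set_pmf \<rho>)"
  shows "pmf (state_transform d \<rho>) b = (\<Sum>a\<in>set_pmf \<rho>. pmf \<rho> a * pmf (d a) b)"
  unfolding state_transform_def pmf_bind
  by (subst integral_measure_pmf_real[OF assms]) (auto simp: mult.commute)

text \<open>
  The value of \<open>dagger c \<sigma> y\<close> is meaningful only if the predicted distribution gives
  positive mass to \<open>y\<close>; see \<open>pmf_dagger\<close>.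
\<close>

definition dagger :: "('x \<Rightarrow> 'y pmf) \<Rightarrow> 'x pmf \<Rightarrow> 'y \<Rightarrow> 'x pmf" where
  "dagger c \<sigma> y =
     embed_pmf (\<lambda>x. pmf \<sigma> x * pmf (c x) y / pmf (state_transform c \<sigma>) y)"

lemma pmf_dagger:
  assumes fin: "finite (set_pmf \<sigma>)" and pos: "pmf (state_transform c \<sigma>) y > 0"
  shows "pmf (dagger c \<sigma> y) x = pmf \<sigma> x * pmf (c x) y / pmf (state_transform c \<sigma>) y"
proof -
  let ?f = "\<lambda>x. pmf \<sigma> x * pmf (c x) y / pmf (state_transform c \<sigma>) y"
  have "(\<integral>\<^sup>+ x. ennreal (?f x) \<partial>count_space UNIV) = (\<Sum>x\<in>set_pmf \<sigma>. ennreal (?f x))"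
    by (rule nn_integral_count_space'[OF fin]) (auto simp: set_pmf_eq)
  also have "\<dots> = ennreal (\<Sum>x\<in>set_pmf \<sigma>. ?f x)"
    by (rule sum_ennreal) simp
  also have "(\<Sum>x\<in>set_pmf \<sigma>. ?f x) = 1"
    using pos by (simp add: pmf_state_transform[OF fin] flip: sum_divide_distrib)
  finally show ?thesis
    unfolding dagger_def by (subst pmf_embed_pmf) auto
qed

text \<open>
  For finitely supported \<open>\<omega>\<close>. A term with \<open>\<omega>(z) > 0\<close> and \<open>\<rho>(z) = 0\<close> makes the
  divergence infinite; this has to be said explicitly, because the total functions
  \<open>/\<close> and \<open>ln\<close> would evaluate such a term to 0.
\<close>

definition KL_div :: "'z pmf \<Rightarrow> 'z pmf \<Rightarrow> ereal" where
  "KL_div \<omega> \<rho> =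
     (if set_pmf \<omega> \<subseteq> set_pmf \<rho>
      then ereal (\<Sum>z\<in>set_pmf \<omega>. pmf \<omega> z * ln (pmf \<omega> z / pmf \<rho> z))
      else \<infinity>)"

end

theory Submission
  imports Defs
begin

text \<open>
  Write \<open>p\<close> and \<open>q\<close> for the predictions from \<open>\<sigma>\<close> and \<open>\<sigma>\<^sub>J\<close>, and \<open>r = \<sigma>\<^sub>J / \<sigma>\<close>. Then
  \<open>q(y) / p(y)\<close> is the mean of \<open>r\<close> under the Bayesian inversion at \<open>y\<close>, so Jensen's inequality
  bounds \<open>ln (q(y) / p(y))\<close> below by the mean of \<open>ln r\<close>. Averaging over \<open>y\<close> with weights \<open>\<tau>\<close>
  turns this mean into the divergence of \<open>\<sigma>\<^sub>J\<close> from \<open>\<sigma>\<close>, which is nonnegative.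
\<close>

text \<open>Jensen's inequality for \<open>ln\<close>. With \<open>s\<close> the mean of
  \<open>f\<close>, the tangent to \<open>ln\<close> at \<open>s\<close> lies above the graph;
  averaging this tangent bound against \<open>\<omega>\<close> leaves exactly \<open>ln s\<close>,
  since the linear part has mean zero.\<close>

lemma sum_pmf_ln_le_ln_sum:
  fixes \<omega> :: "'a pmf" and f :: "'a \<Rightarrow> real"
  assumes fin: "finite (set_pmf \<omega>)" and pos: "\<And>x. x \<in> set_pmf \<omega> \<Longrightarrow> f x > 0"
  shows "(\<Sum>x\<in>set_pmf \<omega>. pmf \<omega> x * ln (f x)) \<le> ln (\<Sum>x\<in>set_pmf \<omega>. pmf \<omega> x * f x)"
proof -
  define s where "s = (\<Sum>x\<in>set_pmf \<omega>. pmf \<omega> x * f x)"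
  have total: "(\<Sum>x\<in>set_pmf \<omega>. pmf \<omega> x) = 1"
    using sum_pmf_eq_1[OF fin] by simp
  have s_pos: "s > 0"
    unfolding s_def using fin pos set_pmf_not_empty by (intro sum_pos mult_pos_pos) (auto intro: pmf_positive)
  have "(\<Sum>x\<in>set_pmf \<omega>. pmf \<omega> x * ln (f x)) \<le>
        (\<Sum>x\<in>set_pmf \<omega>. pmf \<omega> x * (f x / s - 1 + ln s))"
  proof (intro sum_mono mult_left_mono)
    fix x assume "x \<in> set_pmf \<omega>"
    then have "f x > 0" by (rule pos)
    then show "ln (f x) \<le> f x / s - 1 + ln s"
      using ln_le_minus_one[of "f x / s"] s_pos by (simp add: ln_div)
  qed simp
  also have "\<dots> = (\<Sum>x\<in>set_pmf \<omega>. pmf \<omega> x * f x) / s + (\<Sum>x\<in>set_pmf \<omega>. pmf \<omega> x) * (ln s - 1)"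
    unfolding sum_divide_distrib sum_distrib_right sum.distrib[symmetric]
    by (intro sum.cong) (auto simp: algebra_simps)
  also have "\<dots> = ln s"
    using s_pos total by (simp flip: s_def)
  finally show ?thesis by (simp add: s_def)
qed

text \<open>Gibbs' inequality. Jensen is applied to the inverted ratio, whose mean under
  \<open>\<omega>\<close> is the \<open>\<rho>\<close>-mass of the support of
  \<open>\<omega>\<close>, hence at most 1; inverting back flips the sign.\<close>

lemma sum_pmf_ln_ratio_nonneg:
  fixes \<omega> \<rho> :: "'a pmf"
  assumes fin: "finite (set_pmf \<omega>)" and sub: "set_pmf \<omega> \<subseteq> set_pmf \<rho>"
  shows "0 \<le> (\<Sum>x\<in>set_pmf \<omega>. pmf \<omega> x * ln (pmf \<omega> x / pmf \<rho> x))"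
proof -
  have pos: "pmf \<omega> x > 0" "pmf \<rho> x > 0" if "x \<in> set_pmf \<omega>" for x
    using that sub by (auto intro: pmf_positive)
  have "(\<Sum>x\<in>set_pmf \<omega>. pmf \<omega> x * ln (pmf \<rho> x / pmf \<omega> x)) \<le>
        ln (\<Sum>x\<in>set_pmf \<omega>. pmf \<omega> x * (pmf \<rho> x / pmf \<omega> x))"
    using pos by (intro sum_pmf_ln_le_ln_sum fin) auto
  also have "(\<Sum>x\<in>set_pmf \<omega>. pmf \<omega> x * (pmf \<rho> x / pmf \<omega> x)) = (\<Sum>x\<in>set_pmf \<omega>. pmf \<rho> x)"
    by (intro sum.cong) (auto simp: set_pmf_eq)
  also have "\<dots> = measure_pmf.prob \<rho> (set_pmf \<omega>)"
    using fin by (simp add: measure_measure_pmf_finite)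
  \<comment> \<open>Mass zero cannot occur here, but the convention \<open>ln 0 = 0\<close> settles
    that case without an argument.\<close>
  also have "ln \<dots> \<le> 0"
    by (cases "measure_pmf.prob \<rho> (set_pmf \<omega>) = 0")
       (auto simp: zero_less_measure_iff)
  also have "(\<Sum>x\<in>set_pmf \<omega>. pmf \<omega> x * ln (pmf \<rho> x / pmf \<omega> x)) =
      - (\<Sum>x\<in>set_pmf \<omega>. pmf \<omega> x * ln (pmf \<omega> x / pmf \<rho> x))"
    unfolding sum_negf[symmetric]
    using pos by (intro sum.cong) (auto simp: ln_div algebra_simps dest: pos)
  finally show ?thesis by simp
qed

theorem theorem5p1:
  fixes c :: "'x \<Rightarrow> ('y :: finite) pmf" and \<sigma> \<sigma>\<^sub>J :: "'x pmf" and \<tau> :: "'y pmf"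
  assumes "finite (set_pmf \<sigma>)"
    and "\<And>y. pmf (state_transform c \<sigma>) y > 0"
    and "\<sigma>\<^sub>J = state_transform (dagger c \<sigma>) \<tau>"
  shows "KL_div \<tau> (state_transform c \<sigma>\<^sub>J) \<le> KL_div \<tau> (state_transform c \<sigma>)"
proof -
  define p where "p = pmf (state_transform c \<sigma>)"
  define q where "q = pmf (state_transform c \<sigma>\<^sub>J)"
  define D where "D = dagger c \<sigma>"
  define r where "r x = pmf \<sigma>\<^sub>J x / pmf \<sigma> x" for x
  have p_pos: "p y > 0" for y
    using assms(2) by (simp add: p_def)
  have D: "pmf (D y) x = pmf \<sigma> x * pmf (c x) y / p y" for x y
    unfolding D_def p_def by (rule pmf_dagger[OF assms(1,2)])
  have \<sigma>\<^sub>J: "pmf \<sigma>\<^sub>J x = (\<Sum>y\<in>set_pmf \<tau>. pmf \<tau> y * pmf (D y) x)" for x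
    unfolding assms(3) D_def by (rule pmf_state_transform) simp
  have D_sub: "set_pmf (D y) \<subseteq> set_pmf \<sigma>\<^sub>J" if "y \<in> set_pmf \<tau>" for y
    using that by (auto simp: assms(3) state_transform_def D_def)
  have "set_pmf (D y) \<subseteq> set_pmf \<sigma>" for y
    by (auto simp: set_pmf_eq D)
  then have \<sigma>\<^sub>J_sub: "set_pmf \<sigma>\<^sub>J \<subseteq> set_pmf \<sigma>"
    by (auto simp: assms(3) state_transform_def D_def)
  then have fin: "finite (set_pmf \<sigma>\<^sub>J)"
    using assms(1) finite_subset by blast
  have r_pos: "r x > 0" if "x \<in> set_pmf \<sigma>\<^sub>J" for x
    using that \<sigma>\<^sub>J_sub by (auto simp: r_def intro!: divide_pos_pos pmf_positive)
  \<comment> \<open>Bayes' rule \<open>p y * pmf (D y) x = pmf \<sigma> x * pmf (c x) y\<close>,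
    multiplied by \<open>r x\<close>, cancels \<open>pmf \<sigma> x\<close>. The sum may then shrink
    to the support of \<open>D y\<close>, which \<open>D_sub\<close> places inside that of
    \<open>\<sigma>\<^sub>J\<close> when \<open>\<tau>\<close> charges \<open>y\<close>.\<close>
  have q: "q y = p y * (\<Sum>x\<in>set_pmf (D y). pmf (D y) x * r x)" if "y \<in> set_pmf \<tau>" for y
  proof -
    have "q y = (\<Sum>x\<in>set_pmf \<sigma>\<^sub>J. pmf \<sigma>\<^sub>J x * pmf (c x) y)"
      unfolding q_def by (rule pmf_state_transform[OF fin])
    also have "\<dots> = (\<Sum>x\<in>set_pmf \<sigma>\<^sub>J. p y * (pmf (D y) x * r x))"
    proof (intro sum.cong refl)
      fix x assume "x \<in> set_pmf \<sigma>\<^sub>J"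
      then have "pmf \<sigma> x \<noteq> 0" using \<sigma>\<^sub>J_sub by (auto simp: set_pmf_eq)
      then show "pmf \<sigma>\<^sub>J x * pmf (c x) y = p y * (pmf (D y) x * r x)"
        using p_pos[of y] by (simp add: D r_def)
    qed
    also have "\<dots> = (\<Sum>x\<in>set_pmf (D y). p y * (pmf (D y) x * r x))"
      using D_sub[OF that] by (intro sum.mono_neutral_right fin) (auto simp: set_pmf_eq)
    finally show ?thesis by (simp add: sum_distrib_left)
  qed
  have mean_pos: "(\<Sum>x\<in>set_pmf (D y). pmf (D y) x * r x) > 0" if "y \<in> set_pmf \<tau>" for y
    using D_sub[OF that] fin
    by (intro sum_pos mult_pos_pos r_pos)
       (auto intro: finite_subset pmf_positive simp: set_pmf_not_empty)
  have q_pos: "q y > 0" if "y \<in> set_pmf \<tau>" for y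
    using q[OF that] mean_pos[OF that] p_pos by simp
  \<comment> \<open>Summing over the support of \<open>\<sigma>\<^sub>J\<close> instead of that of
    \<open>D y\<close> makes the index set independent of \<open>y\<close>, so that the two sums can
    be swapped below.\<close>
  have jensen: "(\<Sum>x\<in>set_pmf \<sigma>\<^sub>J. pmf (D y) x * ln (r x)) \<le> ln (q y / p y)"
    if "y \<in> set_pmf \<tau>" for y
  proof -
    have "(\<Sum>x\<in>set_pmf \<sigma>\<^sub>J. pmf (D y) x * ln (r x)) = (\<Sum>x\<in>set_pmf (D y). pmf (D y) x * ln (r x))"
      using D_sub[OF that] by (intro sum.mono_neutral_right fin) (auto simp: set_pmf_eq)
    also have "\<dots> \<le> ln (\<Sum>x\<in>set_pmf (D y). pmf (D y) x * r x)"
      using D_sub[OF that] fin r_pos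
      by (intro sum_pmf_ln_le_ln_sum) (auto intro: finite_subset)
    also have "(\<Sum>x\<in>set_pmf (D y). pmf (D y) x * r x) = q y / p y"
      using q[OF that] p_pos[of y] by simp
    finally show ?thesis .
  qed
  have "0 \<le> (\<Sum>x\<in>set_pmf \<sigma>\<^sub>J. pmf \<sigma>\<^sub>J x * ln (r x))"
    unfolding r_def by (rule sum_pmf_ln_ratio_nonneg[OF fin \<sigma>\<^sub>J_sub])
  also have "\<dots> = (\<Sum>x\<in>set_pmf \<sigma>\<^sub>J. \<Sum>y\<in>set_pmf \<tau>. pmf \<tau> y * pmf (D y) x * ln (r x))"
    by (simp add: \<sigma>\<^sub>J sum_distrib_right)
  also have "\<dots> = (\<Sum>y\<in>set_pmf \<tau>. pmf \<tau> y * (\<Sum>x\<in>set_pmf \<sigma>\<^sub>J. pmf (D y) x * ln (r x)))"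
    by (subst sum.swap) (simp add: sum_distrib_left mult.assoc)
  also have "\<dots> \<le> (\<Sum>y\<in>set_pmf \<tau>. pmf \<tau> y * ln (q y / p y))"
    by (intro sum_mono mult_left_mono jensen) simp_all
  also have "\<dots> = (\<Sum>y\<in>set_pmf \<tau>. pmf \<tau> y * ln (pmf \<tau> y / p y)) -
                   (\<Sum>y\<in>set_pmf \<tau>. pmf \<tau> y * ln (pmf \<tau> y / q y))"
    unfolding sum_subtractf[symmetric]
  proof (intro sum.cong refl)
    fix y assume y: "y \<in> set_pmf \<tau>"
    then have "pmf \<tau> y > 0" by (rule pmf_positive)
    then show "pmf \<tau> y * ln (q y / p y) =
        pmf \<tau> y * ln (pmf \<tau> y / p y) - pmf \<tau> y * ln (pmf \<tau> y / q y)"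
      using q_pos[OF y] p_pos[of y] by (simp add: ln_div algebra_simps)
  qed
  finally have le: "(\<Sum>y\<in>set_pmf \<tau>. pmf \<tau> y * ln (pmf \<tau> y / q y)) \<le>
                    (\<Sum>y\<in>set_pmf \<tau>. pmf \<tau> y * ln (pmf \<tau> y / p y))"
    by simp
  \<comment> \<open>The two inclusions put both divergences in the finite branch of
    \<open>KL_div\<close>, where \<open>le\<close> is the claim.\<close>
  moreover have "set_pmf \<tau> \<subseteq> set_pmf (state_transform c \<sigma>\<^sub>J)"
    using q_pos by (force simp: q_def set_pmf_iff)
  moreover have "set_pmf \<tau> \<subseteq> set_pmf (state_transform c \<sigma>)"
    using assms(2) by (auto simp: set_pmf_iff less_le)
  ultimately show ?thesis
    by (simp add: KL_div_def p_def q_def)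
qed

end
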